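(* Let $X$ be a set, let $\mathcal{M}\subseteq\mathcal{P}'(X)$ be a natural family, let $\mathcal{O}$ be a lower-Vietoris-type topology on $\mathcal{M}$, and suppose that $(X,\mathcal{T}_{\mathcal{O}})$ is a $T_2$-space. Then $(X,\mathcal{T}_{\mathcal{O}})$ is compact if and only if $(\mathcal{M},\mathcal{O})$ is compact.
   Context: $\mathcal{P}'(X)$ is the set of all non-empty subsets of $X$. $\mathcal{M}$ is a natural family in $X$ if $\{x\}\in\mathcal{M}$ for every $x\in X$. For $A\subseteq X$, $A_{\mathcal{M}}^-=\{M\in\mathcal{M}\mid M\cap A\neq\emptyset\}$. A topology $\mathcal{O}$ on $\mathcal{M}$ is a lower-Vietoris-type topology if $\mathcal{O}\cap\{A_{\mathcal{M}}^-\mid A\subseteq X\}$ is a subbase for $\mathcal{O}$. Put $\mathcal{P}_{\mathcal{O}}=\{A\subseteq X\mid A_{\mathcal{M}}^-\in\mathcal{O}\}$; this family contains $X$, and $\mathcal{T}_{\mathcal{O}}$ is the topology on $X$ having $\mathcal{P}_{\mathcal{O}}$ as a subbase. Compactness means that every open cover has a finite subcover (no separation axiom is included). *)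

theory Defs
  imports "HOL-Analysis.Analysis"
begin

(* The topology on the set U with subbase S: unions of finite intersections of members of S,
   where the empty intersection is U itself (hence the relativisation to U). *)
definition subbase_topology :: "'a set \<Rightarrow> 'a set set \<Rightarrow> 'a topology" where
  "subbase_topology U S =
     topology (arbitrary union_of (finite intersection_of (\<lambda>V. V \<in> S) relative_to U))"

definition natural_family :: "'a set \<Rightarrow> 'a set set \<Rightarrow> bool" where
  "natural_family X \<M> \<longleftrightarrow> (\<forall>x\<in>X. {x} \<in> \<M>)"

definition hit :: "'a set set \<Rightarrow> 'a set \<Rightarrow> 'a set set" where
  "hit \<M> A = {M \<in> \<M>. M \<inter> A \<noteq> {}}"

definition lower_vietoris_type :: "'a set \<Rightarrow> 'a set set \<Rightarrow> 'a set topology \<Rightarrow> bool" where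
  "lower_vietoris_type X \<M> \<O> \<longleftrightarrow>
     topspace \<O> = \<M> \<and>
     \<O> = subbase_topology \<M> ({W. openin \<O> W} \<inter> {hit \<M> A | A. A \<subseteq> X})"

definition hit_open_sets :: "'a set \<Rightarrow> 'a set set \<Rightarrow> 'a set topology \<Rightarrow> 'a set set" where
  "hit_open_sets X \<M> \<O> = {A. A \<subseteq> X \<and> openin \<O> (hit \<M> A)}"

definition hit_topology :: "'a set \<Rightarrow> 'a set set \<Rightarrow> 'a set topology \<Rightarrow> 'a topology" where
  "hit_topology X \<M> \<O> = subbase_topology X (hit_open_sets X \<M> \<O>)"

lemma topspace_subbase_topology [simp]: "topspace (subbase_topology U S) = U"
  by (simp add: subbase_topology_def)

lemma topspace_hit_topology [simp]: "topspace (hit_topology X \<M> \<O>) = X"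
  by (simp add: hit_topology_def)

end

theory Submission
  imports Defs
begin

text \<open>
  The sets \<open>hit \<M> A\<close> translate covers of \<open>X\<close> into covers of \<open>\<M>\<close> and back. If a family
  \<open>\<A>\<close> of subsets of \<open>X\<close> covers \<open>X\<close>, every \<open>M \<in> \<M>\<close>, being a non-empty part of \<open>X\<close>,
  meets some member of \<open>\<A>\<close>; conversely, if every \<open>M \<in> \<M>\<close> meets some member, then the
  singletons in \<open>\<M>\<close> show that every point of \<open>X\<close> lies in one. So \<open>\<A>\<close> covers \<open>X\<close> iff its
  image under \<open>hit \<M>\<close> covers \<open>\<M>\<close> (\<open>hit_image_covers_iff\<close>), and this applies to finite
  subfamilies as well.

  By definition the two topologies have matching subbases: \<open>hit_open_sets X \<M> \<O>\<close> generates
  the topology on \<open>X\<close>, and its image under \<open>hit \<M>\<close> generates \<open>\<O>\<close>. By Alexander's theorem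
  compactness can be tested on subbasic covers (\<open>compact_space_subbase_topology_iff\<close>), and
  for these the two tests agree.
\<close>

lemma openin_subbase_topology:
  assumes "V \<in> S" "V \<subseteq> U"
  shows "openin (subbase_topology U S) V"
proof -
  have "(finite intersection_of (\<lambda>V. V \<in> S) relative_to U) V"
    using assms by (intro relative_to_subset_inc finite_intersection_of_inc)
  then show ?thesis
    by (simp add: subbase_topology_def openin_subbase arbitrary_union_of_inc)
qed

text \<open>
  Alexander's subbase theorem as an equivalence. The subbase has to cover \<open>U\<close>: if a point
  of \<open>U\<close> lies outside \<open>\<Union>S\<close>, then no subfamily of \<open>S\<close> covers \<open>U\<close> and the condition on
  the right is vacuous; every open set containing that point is then \<open>U\<close> itself.
\<close>

lemma compact_space_subbase_topology_iff:
  assumes "S \<subseteq> Pow U" "U \<subseteq> \<Union>S"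
  shows "compact_space (subbase_topology U S) \<longleftrightarrow>
    (\<forall>\<C>\<subseteq>S. U \<subseteq> \<Union>\<C> \<longrightarrow> (\<exists>\<F>. finite \<F> \<and> \<F> \<subseteq> \<C> \<and> U \<subseteq> \<Union>\<F>))"
    (is "?compact \<longleftrightarrow> ?covers")
proof
  assume compact: ?compact
  show ?covers
  proof (intro allI impI)
    fix \<C> assume \<C>: "\<C> \<subseteq> S" "U \<subseteq> \<Union>\<C>"
    then have "\<forall>V\<in>\<C>. openin (subbase_topology U S) V"
      using assms(1) by (blast intro: openin_subbase_topology)
    then show "\<exists>\<F>. finite \<F> \<and> \<F> \<subseteq> \<C> \<and> U \<subseteq> \<Union>\<F>"
      using compact \<C>(2) by (simp add: compact_space_alt)
  qed
next
  assume ?covers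
  then show ?compact
    by (intro Alexander_subbase_alt [OF assms(2)]) (auto simp: subbase_topology_def)
qed

lemma hit_image_covers_iff:
  assumes "\<M> \<subseteq> Pow X - {{}}" "natural_family X \<M>"
  shows "\<M> \<subseteq> \<Union>(hit \<M> ` \<A>) \<longleftrightarrow> X \<subseteq> \<Union>\<A>"
proof
  assume cover: "\<M> \<subseteq> \<Union>(hit \<M> ` \<A>)"
  show "X \<subseteq> \<Union>\<A>"
  proof
    fix x assume "x \<in> X"
    then have "{x} \<in> \<Union>(hit \<M> ` \<A>)"
      using assms(2) cover by (auto simp: natural_family_def)
    then show "x \<in> \<Union>\<A>"
      by (auto simp: hit_def)
  qed
next
  assume cover: "X \<subseteq> \<Union>\<A>"
  show "\<M> \<subseteq> \<Union>(hit \<M> ` \<A>)"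
  proof
    fix M assume M: "M \<in> \<M>"
    then obtain x where "x \<in> M" "x \<in> X"
      using assms(1) by blast
    then obtain A where "A \<in> \<A>" "x \<in> A"
      using cover by blast
    with M \<open>x \<in> M\<close> show "M \<in> \<Union>(hit \<M> ` \<A>)"
      by (auto simp: hit_def)
  qed
qed

theorem proposition4p1:
  fixes X :: "'a set" and \<M> :: "'a set set" and \<O> :: "'a set topology"
  assumes "\<M> \<subseteq> Pow X - {{}}"
    and "natural_family X \<M>"
    and "lower_vietoris_type X \<M> \<O>"
    and "Hausdorff_space (hit_topology X \<M> \<O>)"
  shows "compact_space (hit_topology X \<M> \<O>) \<longleftrightarrow> compact_space \<O>"
proof -
  define P where "P = hit_open_sets X \<M> \<O>"
  have covers_iff: "\<M> \<subseteq> \<Union>(hit \<M> ` \<A>) \<longleftrightarrow> X \<subseteq> \<Union>\<A>" for \<A>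
    by (rule hit_image_covers_iff [OF assms(1,2)])
  have top: "topspace \<O> = \<M>"
    and gen: "\<O> = subbase_topology \<M> ({W. openin \<O> W} \<inter> {hit \<M> A | A. A \<subseteq> X})"
    using assms(3) by (simp_all add: lower_vietoris_type_def)
  have "{W. openin \<O> W} \<inter> {hit \<M> A | A. A \<subseteq> X} = hit \<M> ` P"
    by (auto simp: P_def hit_open_sets_def)
  with gen have \<O>_eq: "\<O> = subbase_topology \<M> (hit \<M> ` P)"
    by simp
  have "hit \<M> X = \<M>"
    using assms(1) by (auto simp: hit_def)
  then have "X \<in> P"
    using top openin_topspace [of \<O>] by (simp add: P_def hit_open_sets_def)
  then have P_covers: "X \<subseteq> \<Union>P"
    by blast
  have "compact_space (hit_topology X \<M> \<O>) \<longleftrightarrow>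
    (\<forall>\<A>\<subseteq>P. X \<subseteq> \<Union>\<A> \<longrightarrow> (\<exists>\<F>. finite \<F> \<and> \<F> \<subseteq> \<A> \<and> X \<subseteq> \<Union>\<F>))"
    unfolding hit_topology_def P_def [symmetric]
  proof (rule compact_space_subbase_topology_iff [OF _ P_covers])
    show "P \<subseteq> Pow X"
      by (auto simp: P_def hit_open_sets_def)
  qed
  also have "\<dots> \<longleftrightarrow> (\<forall>\<A>\<subseteq>P. \<M> \<subseteq> \<Union>(hit \<M> ` \<A>) \<longrightarrow>
    (\<exists>\<F>. finite \<F> \<and> \<F> \<subseteq> \<A> \<and> \<M> \<subseteq> \<Union>(hit \<M> ` \<F>)))"
    by (simp only: covers_iff)
  also have "\<dots> \<longleftrightarrow> (\<forall>\<C>\<subseteq>hit \<M> ` P. \<M> \<subseteq> \<Union>\<C> \<longrightarrow>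
    (\<exists>\<F>. finite \<F> \<and> \<F> \<subseteq> \<C> \<and> \<M> \<subseteq> \<Union>\<F>))"
    by (simp only: all_subset_image ex_finite_subset_image)
  also have "\<dots> \<longleftrightarrow> compact_space (subbase_topology \<M> (hit \<M> ` P))"
  proof (rule compact_space_subbase_topology_iff [symmetric])
    show "hit \<M> ` P \<subseteq> Pow \<M>"
      by (auto simp: hit_def)
    show "\<M> \<subseteq> \<Union>(hit \<M> ` P)"
      using P_covers by (simp only: covers_iff)
  qed
  finally show ?thesis
    by (simp only: \<O>_eq [symmetric])
qed

end
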